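(* Let $(X,\mathcal A,\mu,T)$ be a conservative ergodic infinite measure preserving system (as in the context). Let $N$ be a $T$-point process on $(\Omega,\mathscr F,\mathbb P,S)$ which almost surely assigns finite mass to any $T$-orbit. Then there exist a finite or countable set $I$, a family $\{F_i\}_{i\in I}$ of finite subsets of $\mathbb Z_+$, and a family $(N_{F_i})_{i\in I}$ of free $T$-point processes, measurable with respect to $N$ and mutually dissociated, such that $$N=\sum_{i\in I}\left(\sum_{k\in F_i}N_{F_i}\circ S^k\right),\quad \mathbb P\text{-a.s.}$$
   Context: Setting. $X$ is a complete separable metric space with Borel $\sigma$-algebra $\mathcal A$; $\mu$ is a measure on $(X,\mathcal A)$ that is boundedly finite (finite on bounded Borel sets), with $\mu(X)=\infty$; $T:X\to X$ is invertible and preserves $\mu$, and $(X,\mathcal A,\mu,T)$ is conservative and ergodic. $X^*$ is the set of boundedly finite simple counting measures $\xi=\sum_{i\in I}\delta_{x_i}$ ($I$ at most countable, $x_i\ne x_j$ for $i\neq j$), identified with the corresponding sets of points, and $\mathcal A^*$ is the $\sigma$-algebra on $X^*$ generated by the maps $\xi\mapsto \xi(A)$, $A$ bounded Borel. $T$-point process. $(\Omega,\mathscr F,\mathbb P)$ is a probability space and $S$ an invertible measure preserving transformation of it. A $T$-point process defined on $(\Omega,\mathscr F,\mathbb P,S)$ is a measurable map $N:\Omega\to X^*$ such that (i) for each $A\in\mathcal A$ with $\mu(A)=0$, $N(\omega)(A)=0$ for $\mathbb P$-a.e. $\omega$; (ii) for $\mathbb P$-a.e. $\omega$, for all $A\in\mathcal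 A$, $N(S\omega)(A)=N(\omega)(T^{-1}A)$. $N$ is free if for $\mathbb P$-a.e. $\omega$, for all $k\in\mathbb Z\setminus\{0\}$, $N(\omega)\cap N(S^k\omega)=\emptyset$. Two $T$-point processes $N_1,N_2$ on $(\Omega,\mathscr F,\mathbb P,S)$ are dissociated if for $\mathbb P$-a.e. $\omega$, for all $k\in\mathbb Z$, $N_1(\omega)\cap N_2(S^k\omega)=\emptyset$. *)

theory Defs
  imports "HOL-Probability.Probability"
begin

section \<open>Measure preserving systems\<close>

definition mp_automorphism :: "'a measure \<Rightarrow> ('a \<Rightarrow> 'a) \<Rightarrow> bool" where
  "mp_automorphism M f \<longleftrightarrow>
     bij_betw f (space M) (space M) \<and>
     f \<in> measurable M M \<and>
     inv_into (space M) f \<in> measurable M M \<and>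
     distr M M f = M"

text \<open>\<open>ziter Y f k\<close> is the \<open>k\<close>-th iterate, \<open>k\<close> an integer, of a bijection \<open>f\<close> of \<open>Y\<close>;
  it is meaningful only at points of \<open>Y\<close>.\<close>

definition ziter :: "'a set \<Rightarrow> ('a \<Rightarrow> 'a) \<Rightarrow> int \<Rightarrow> 'a \<Rightarrow> 'a" where
  "ziter Y f k = (if 0 \<le> k then f ^^ nat k else inv_into Y f ^^ nat (- k))"

definition conservative :: "'a measure \<Rightarrow> ('a \<Rightarrow> 'a) \<Rightarrow> bool" where
  "conservative M f \<longleftrightarrow>
     (\<forall>W\<in>sets M. disjoint_family (\<lambda>n::nat. (f ^^ n) -` W \<inter> space M) \<longrightarrow> emeasure M W = 0)"

definition ergodic :: "'a measure \<Rightarrow> ('a \<Rightarrow> 'a) \<Rightarrow> bool" where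
  "ergodic M f \<longleftrightarrow>
     (\<forall>A\<in>sets M. f -` A \<inter> space M = A \<longrightarrow> emeasure M A = 0 \<or> emeasure M (space M - A) = 0)"

text \<open>The complete separable metric space is the whole type, whose class supplies the metric
  to which \<open>bounded\<close> refers.\<close>

definition conservative_ergodic_infinite_system ::
    "'a::polish_space measure \<Rightarrow> ('a \<Rightarrow> 'a) \<Rightarrow> bool" where
  "conservative_ergodic_infinite_system \<mu> T \<longleftrightarrow>
     sets \<mu> = sets borel \<and>
     (\<forall>A\<in>sets borel. bounded A \<longrightarrow> emeasure \<mu> A < \<infinity>) \<and>
     emeasure \<mu> UNIV = \<infinity> \<and>
     mp_automorphism \<mu> T \<and> conservative \<mu> T \<and> ergodic \<mu> T"

section \<open>Point configurations\<close>

text \<open>A simple counting measure is identified with its set of points \<open>\<xi>\<close>; \<open>mass \<xi>\<close> is the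
  measure itself, i.e. the sum of the Dirac masses at the points of \<open>\<xi>\<close>.\<close>

definition mass :: "'a set \<Rightarrow> 'a set \<Rightarrow> ennreal" where
  "mass \<xi> A = emeasure (count_space UNIV) (\<xi> \<inter> A)"

definition configs :: "'a::polish_space set set" where
  "configs = {\<xi>. countable \<xi> \<and> (\<forall>A\<in>sets borel. bounded A \<longrightarrow> mass \<xi> A < \<infinity>)}"

text \<open>Only the space and the \<open>\<sigma>\<close>-algebra of this measure matter.\<close>

definition config_algebra :: "'a::polish_space set measure" where
  "config_algebra = sigma configs
     {{\<xi> \<in> configs. mass \<xi> A \<in> B} | A B. A \<in> sets borel \<and> bounded A \<and> B \<in> sets borel}"

section \<open>\<open>T\<close>-point processes\<close>

definition T_point_process ::
    "'a::polish_space measure \<Rightarrow> ('a \<Rightarrow> 'a) \<Rightarrow> 'w measure \<Rightarrow> ('w \<Rightarrow> 'w) \<Rightarrow> ('w \<Rightarrow> 'a set) \<Rightarrow> bool" where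
  "T_point_process \<mu> T P S N \<longleftrightarrow>
     N \<in> measurable P config_algebra \<and>
     (\<forall>A\<in>sets borel. emeasure \<mu> A = 0 \<longrightarrow> (AE \<omega> in P. mass (N \<omega>) A = 0)) \<and>
     (AE \<omega> in P. \<forall>A\<in>sets borel. mass (N (S \<omega>)) A = mass (N \<omega>) (T -` A))"

definition free_process :: "'w measure \<Rightarrow> ('w \<Rightarrow> 'w) \<Rightarrow> ('w \<Rightarrow> 'a set) \<Rightarrow> bool" where
  "free_process P S N \<longleftrightarrow>
     (AE \<omega> in P. \<forall>k::int. k \<noteq> 0 \<longrightarrow> N \<omega> \<inter> N (ziter (space P) S k \<omega>) = {})"

definition dissociated ::
    "'w measure \<Rightarrow> ('w \<Rightarrow> 'w) \<Rightarrow> ('w \<Rightarrow> 'a set) \<Rightarrow> ('w \<Rightarrow> 'a set) \<Rightarrow> bool" where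
  "dissociated P S N1 N2 \<longleftrightarrow>
     (AE \<omega> in P. \<forall>k::int. N1 \<omega> \<inter> N2 (ziter (space P) S k \<omega>) = {})"

definition orbit :: "('a \<Rightarrow> 'a) \<Rightarrow> 'a \<Rightarrow> 'a set" where
  "orbit T x = range (\<lambda>k. ziter UNIV T k x)"

text \<open>Measurability with respect to \<open>N\<close> is measurability for the \<open>\<sigma>\<close>-algebra generated by
  \<open>N\<close>, without completion.\<close>

definition measurable_wrt ::
    "'w measure \<Rightarrow> ('w \<Rightarrow> 'a::polish_space set) \<Rightarrow> ('w \<Rightarrow> 'a set) \<Rightarrow> bool" where
  "measurable_wrt P N N' \<longleftrightarrow>
     N' \<in> measurable (vimage_algebra (space P) N config_algebra) config_algebra"

end

theory Submission
  imports Defs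
begin

text \<open>
  The part of \<open>N \<omega>\<close> on a \<open>T\<close>-orbit is a finite set of positions along a copy of the integers, so
  if it is not empty it has a first point \<open>x\<close>. The finite set
  \<open>F = {k. T\<^sup>k x \<in> N \<omega>}\<close>, which contains \<open>0\<close> and only nonnegative integers, is the pattern of the
  orbit read from its first point. Let \<open>N\<^sub>F \<omega>\<close> be the set of the points of \<open>N \<omega>\<close> from which the
  pattern \<open>F\<close> is read (\<open>origins\<close>). An orbit with pattern \<open>F\<close> meets \<open>N \<omega>\<close> exactly in the points
  \<open>T\<^sup>k x\<close>, \<open>k \<in> F\<close>, so \<open>N \<omega>\<close> is the disjoint union of the sets \<open>T\<^sup>k N\<^sub>F \<omega>\<close> over all \<open>F\<close> and all
  \<open>k \<in> F\<close> (\<open>ex_origin\<close>, \<open>origins_unique\<close>); and \<open>T\<^sup>k N\<^sub>F \<omega> = N\<^sub>F (S\<^sup>k \<omega>)\<close>, because reading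
  patterns commutes with \<open>T\<close> (\<open>origins_shift\<close>) and \<open>N (S\<^sup>k \<omega>) = T\<^sup>k N \<omega>\<close> (\<open>process_ziter\<close>). Since an orbit has at most one first point, \<open>N\<^sub>F\<close> is
  free, and \<open>N\<^sub>F\<close>, \<open>N\<^sub>G\<close> are dissociated for \<open>F \<noteq> G\<close>.

  Two points need work. First, an orbit is a copy of the integers only if it is not periodic. The
  points of period \<open>n\<close> are \<open>\<mu>\<close>-null (\<open>periodic_points_null\<close>): otherwise they contain an invariant
  set of positive finite measure, namely the saturation of a part of finite measure, which
  ergodicity forbids in an infinite system. Hence almost surely \<open>N\<close> has no periodic points.
  Secondly, \<open>N\<^sub>F\<close> has to be a measurable function of \<open>N\<close>. This follows from two facts: the
  relation \<open>x \<in> \<xi>\<close> is jointly measurable in \<open>\<xi>\<close> and \<open>x\<close> (\<open>sets_member_relation\<close>), and counting the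
  points of \<open>\<xi>\<close> in a section of a jointly measurable set is measurable in \<open>\<xi>\<close>
  (\<open>measurable_mass_section\<close>).
\<close>

section \<open>Integer iterates of a bijection\<close>

lemma ziter_0 [simp]: "ziter Y f 0 x = x"
  by (simp add: ziter_def)

lemma ziter_of_nat: "ziter Y f (int n) = f ^^ n"
  by (simp add: ziter_def)

lemma ziter_in:
  assumes "bij_betw f Y Y" "y \<in> Y"
  shows "ziter Y f k y \<in> Y"
proof -
  have "bij_betw (ziter Y f k) Y Y"
    unfolding ziter_def using assms(1) by (simp add: bij_betw_funpow bij_betw_inv_into)
  then show ?thesis using assms(2) by (rule bij_betwE[rule_format])
qed

lemma ziter_Suc:
  assumes "bij_betw f Y Y" "y \<in> Y"
  shows "ziter Y f (k + 1) y = f (ziter Y f k y)"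
proof (cases "0 \<le> k")
  case True
  then show ?thesis by (simp add: ziter_def nat_add_distrib)
next
  case False
  then have eq: "nat (- k) = Suc (nat (- (k + 1)))" by simp
  have "ziter Y f (k + 1) y = (inv_into Y f ^^ nat (- (k + 1))) y"
    using False by (cases "k = -1") (auto simp: ziter_def)
  moreover from this have "(inv_into Y f ^^ nat (- (k + 1))) y \<in> f ` Y"
    using ziter_in[OF assms, of "k + 1"] assms(1) by (simp add: bij_betw_def)
  ultimately show ?thesis
    using False by (simp add: ziter_def[of _ _ k] eq f_inv_into_f)
qed

lemma ziter_add:
  assumes "bij f"
  shows "ziter UNIV f (j + k) x = ziter UNIV f j (ziter UNIV f k x)"
proof (induction j rule: int_induct[of _ 0])
  case base
  then show ?case by simp
next
  case (step1 i)
  then show ?case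
    using ziter_Suc[OF assms, of x "i + k"] ziter_Suc[OF assms, of "ziter UNIV f k x" i]
    by (simp add: ac_simps)
next
  case (step2 i)
  then have "f (ziter UNIV f (i - 1 + k) x) = f (ziter UNIV f (i - 1) (ziter UNIV f k x))"
    using ziter_Suc[OF assms, of x "i - 1 + k"] ziter_Suc[OF assms, of "ziter UNIV f k x" "i - 1"]
    by (simp add: ac_simps)
  then show ?case using assms by (simp add: bij_is_inj inj_eq)
qed

lemma ziter_inverse [simp]:
  assumes "bij f"
  shows "ziter UNIV f (- k) (ziter UNIV f k x) = x"
  using ziter_add[OF assms, of "- k" k x] by simp

lemma inj_ziter:
  assumes "bij f"
  shows "inj (ziter UNIV f k)"
  by (rule inj_on_inverseI[where g = "ziter UNIV f (- k)"]) (simp add: assms)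

lemma inj_ziter_orbit:
  assumes "bij f" and aper: "\<And>n. 0 < n \<Longrightarrow> (f ^^ n) x \<noteq> x"
  shows "inj (\<lambda>k. ziter UNIV f k x)"
proof (rule injI)
  have no_pos: "ziter UNIV f k x \<noteq> x" if "0 < k" for k
    using aper[of "nat k"] that by (simp add: ziter_def)
  have less: "ziter UNIV f i x \<noteq> ziter UNIV f j x" if "i < j" for i j
  proof
    assume "ziter UNIV f i x = ziter UNIV f j x"
    then have "ziter UNIV f (- i + j) x = x"
      using ziter_add[OF assms(1), of "- i" j x] assms(1) by (metis ziter_inverse)
    with no_pos[of "- i + j"] that show False by simp
  qed
  fix i j assume "ziter UNIV f i x = ziter UNIV f j x"
  with less[of i j] less[of j i] show "i = j" by (metis linorder_cases)
qed

lemma measure_preserving_funpow: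
  assumes "f \<in> measurable M M" "distr M M f = M"
  shows "f ^^ n \<in> measurable M M \<and> distr M M (f ^^ n) = M"
proof (induction n)
  case 0
  have "distr M M (\<lambda>x. x) = M" by (rule distr_id)
  then show ?case by (simp add: id_def)
next
  case (Suc n)
  then have "distr M M (f \<circ> f ^^ n) = distr (distr M M (f ^^ n)) M f"
    using assms(1) by (intro distr_distr[symmetric]) auto
  also have "\<dots> = M" using Suc assms(2) by simp
  finally have "distr M M (f \<circ> f ^^ n) = M" .
  moreover have "f \<circ> f ^^ n \<in> measurable M M"
    using Suc assms(1) by (intro measurable_comp) auto
  ultimately show ?case by (simp only: funpow.simps(2) simp_thms)
qed

lemma mp_automorphism_inverse:
  assumes "mp_automorphism M f"
  shows "distr M M (inv_into (space M) f) = M"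
proof -
  have f: "f \<in> measurable M M" and g: "inv_into (space M) f \<in> measurable M M"
    and d: "distr M M f = M" and b: "bij_betw f (space M) (space M)"
    using assms by (simp_all add: mp_automorphism_def)
  have "distr M M (inv_into (space M) f) = distr (distr M M f) M (inv_into (space M) f)"
    by (simp add: d)
  also have "\<dots> = distr M M (inv_into (space M) f \<circ> f)" by (rule distr_distr[OF g f])
  also have "\<dots> = distr M M (\<lambda>x. x)"
    using b by (intro distr_cong) (auto simp: bij_betw_def)
  finally show ?thesis by simp
qed

lemma mp_automorphism_ziter:
  assumes "mp_automorphism M f"
  shows "ziter (space M) f k \<in> measurable M M" "distr M M (ziter (space M) f k) = M"
  using assms mp_automorphism_inverse[OF assms]
  by (auto simp: ziter_def mp_automorphism_def measure_preserving_funpow)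

lemma AE_all_ziter:
  assumes "mp_automorphism M f" "AE x in M. Q x"
  shows "AE x in M. \<forall>k::int. Q (ziter (space M) f k x)"
proof -
  have "AE x in M. Q (ziter (space M) f k x)" for k
    by (rule AE_distrD[OF mp_automorphism_ziter(1)[OF assms(1)]])
      (unfold mp_automorphism_ziter(2)[OF assms(1)], rule assms(2))
  then show ?thesis by (simp add: AE_all_countable)
qed

section \<open>Periodic points of an infinite ergodic system\<close>

text \<open>On the set where \<open>T\<^sup>n\<close> is the identity, the preimages of a ball under \<open>T\<^sup>0, \<dots>, T\<^bsup>n-1\<^esup>\<close> are
  permuted cyclically by \<open>T\<close>, so their union is invariant, and its measure is finite. By ergodicity
  it is null, as its complement has infinite measure; and the balls of integer radius around one
  point exhaust the space.\<close>

lemma periodic_points_null: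
  fixes \<mu> :: "'a::polish_space measure"
  assumes sys: "conservative_ergodic_infinite_system \<mu> T" and n: "0 < n"
  shows "{x. (T ^^ n) x = x} \<in> sets borel" "emeasure \<mu> {x. (T ^^ n) x = x} = 0"
proof -
  have sets: "sets \<mu> = sets borel" and inf: "emeasure \<mu> UNIV = \<infinity>"
    and fin: "\<And>A. A \<in> sets borel \<Longrightarrow> bounded A \<Longrightarrow> emeasure \<mu> A < \<infinity>"
    and mp: "mp_automorphism \<mu> T" and erg: "ergodic \<mu> T"
    using sys by (auto simp: conservative_ergodic_infinite_system_def)
  have space: "space \<mu> = UNIV" using sets_eq_imp_space_eq[OF sets] by simp
  have bij: "bij T" and T: "T \<in> measurable \<mu> \<mu>" and TP: "distr \<mu> \<mu> T = \<mu>"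
    using mp by (simp_all add: mp_automorphism_def space)
  have Tk: "T ^^ k \<in> measurable \<mu> \<mu>" "distr \<mu> \<mu> (T ^^ k) = \<mu>" for k
    using measure_preserving_funpow[OF T TP] by auto
  let ?P = "{x. (T ^^ n) x = x}"
  have "T ^^ n \<in> borel_measurable borel"
    using Tk(1)[of n] measurable_cong_sets[OF sets sets] by simp
  then have "{x \<in> space borel. (T ^^ n) x = x} \<in> sets borel"
    by (intro measurable_equality_set) auto
  then show P: "?P \<in> sets borel" by simp
  define U where "U m = (\<Union>k<n. (T ^^ k) -` ball undefined (real m)) \<inter> ?P" for m
  have pre: "(T ^^ k) -` ball undefined (real m) \<in> sets \<mu>" for k m
    using measurable_sets[OF Tk(1)[of k], of "ball undefined (real m)"] by (simp add: space sets)
  have U: "U m \<in> sets \<mu>" for m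
    unfolding U_def using pre P by (intro sets.Int sets.countable_UN'') (auto simp: sets)
  have U_fin: "emeasure \<mu> (U m) < \<infinity>" for m
  proof -
    have "emeasure \<mu> (U m) \<le> emeasure \<mu> (\<Union>k<n. (T ^^ k) -` ball undefined (real m))"
      unfolding U_def using pre by (intro emeasure_mono sets.countable_UN'') auto
    also have "\<dots> \<le> (\<Sum>k<n. emeasure \<mu> ((T ^^ k) -` ball undefined (real m)))"
      using pre by (intro emeasure_subadditive_finite) auto
    also have "\<dots> = (\<Sum>k<n. emeasure \<mu> (ball undefined (real m)))"
    proof (rule sum.cong[OF refl])
      fix k
      have "emeasure (distr \<mu> \<mu> (T ^^ k)) (ball undefined (real m))
          = emeasure \<mu> ((T ^^ k) -` ball undefined (real m))"
        using Tk(1) by (subst emeasure_distr) (auto simp: sets space)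
      then show "emeasure \<mu> ((T ^^ k) -` ball undefined (real m))
          = emeasure \<mu> (ball undefined (real m))"
        by (simp add: Tk(2))
    qed
    also have "\<dots> < \<infinity>"
      using fin[of "ball undefined (real m)"] by (simp add: ennreal_mult_less_top of_nat_less_top)
    finally show ?thesis .
  qed
  have U_inv: "T -` U m = U m" for m
  proof (rule set_eqI)
    fix x
    have per: "T x \<in> ?P \<longleftrightarrow> x \<in> ?P"
      using bij by (simp add: funpow_swap1[symmetric] bij_is_inj inj_eq)
    have cycle: "(\<exists>k<n. (T ^^ k) (T x) \<in> B) \<longleftrightarrow> (\<exists>k<n. (T ^^ k) x \<in> B)" if x: "(T ^^ n) x = x" for B
    proof
      assume "\<exists>k<n. (T ^^ k) (T x) \<in> B"
      then obtain k where k: "k < n" "(T ^^ Suc k) x \<in> B" by (auto simp: funpow_swap1)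
      then show "\<exists>k<n. (T ^^ k) x \<in> B"
      proof (cases "Suc k < n")
        case False
        with k(1) have "Suc k = n" by simp
        with k(2) x have "(T ^^ 0) x \<in> B" by simp
        with n show ?thesis by blast
      qed blast
    next
      assume "\<exists>k<n. (T ^^ k) x \<in> B"
      then obtain k where k: "k < n" "(T ^^ k) x \<in> B" by auto
      show "\<exists>k<n. (T ^^ k) (T x) \<in> B"
      proof (cases k)
        case 0
        obtain n' where n': "n = Suc n'" using n by (cases n) auto
        with x 0 k have "(T ^^ n') (T x) \<in> B" by (simp add: funpow_swap1)
        with n' show ?thesis by auto
      next
        case (Suc k')
        with k have "k' < n" "(T ^^ k') (T x) \<in> B" by (simp_all add: funpow_swap1)
        then show ?thesis by auto
      qed
    qed
    show "x \<in> T -` U m \<longleftrightarrow> x \<in> U m"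
      using per cycle[of "ball undefined (real m)"]
      by (cases "x \<in> ?P") (simp_all add: U_def Bex_def)
  qed
  have U_null: "emeasure \<mu> (U m) = 0" for m
  proof (rule ccontr)
    assume "emeasure \<mu> (U m) \<noteq> 0"
    then have "emeasure \<mu> (UNIV - U m) = 0"
      using erg[unfolded ergodic_def, rule_format, OF U, of m] U_inv[of m] by (simp add: space)
    moreover have "emeasure \<mu> (U m) + emeasure \<mu> (UNIV - U m) = emeasure \<mu> (U m \<union> (UNIV - U m))"
      using U[of m] sets.compl_sets[OF U[of m]] by (intro plus_emeasure) (auto simp: space)
    ultimately show False using U_fin[of m] inf by (simp add: Un_UNIV_right)
  qed
  have "?P \<subseteq> (\<Union>m. U m)"
  proof
    fix x assume x: "x \<in> ?P"
    obtain m where "dist undefined x < real m" using reals_Archimedean2 by blast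
    then have "(T ^^ 0) x \<in> ball undefined (real m)" by simp
    with x n have "x \<in> U m" unfolding U_def by blast
    then show "x \<in> (\<Union>m. U m)" by blast
  qed
  moreover have "(\<Union>m. U m) \<in> null_sets \<mu>" using U U_null by (intro null_sets_UN) auto
  ultimately show "emeasure \<mu> ?P = 0"
    using P sets by (auto intro!: null_setsD1 intro: null_sets_subset)
qed

section \<open>Measurability on the space of configurations\<close>

lemma mass_finite_iff: "mass \<xi> A < \<infinity> \<longleftrightarrow> finite (\<xi> \<inter> A)"
  by (simp add: mass_def emeasure_count_space of_nat_less_top)

lemma mass_eq_0_iff: "mass \<xi> A = 0 \<longleftrightarrow> \<xi> \<inter> A = {}"
  by (simp add: mass_def emeasure_count_space_eq_0)

lemma mass_mono: "\<xi> \<inter> A \<subseteq> \<eta> \<inter> B \<Longrightarrow> mass \<xi> A \<le> mass \<eta> B"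
  unfolding mass_def by (rule emeasure_mono) auto

lemma mass_image:
  assumes "inj f"
  shows "mass (f ` \<xi>) A = mass \<xi> (f -` A)"
proof -
  have "f ` \<xi> \<inter> A = f ` (\<xi> \<inter> f -` A)" by auto
  then show ?thesis
    using inj_on_subset[OF assms]
    by (simp add: mass_def emeasure_count_space card_image finite_image_iff)
qed

lemma space_config_algebra [simp]: "space config_algebra = configs"
  unfolding config_algebra_def by (rule space_measure_of) auto

lemma measurable_mass:
  fixes A :: "'a::polish_space set"
  assumes "A \<in> sets borel" "bounded A"
  shows "(\<lambda>\<xi>. mass \<xi> A) \<in> borel_measurable config_algebra"
proof (rule measurableI)
  fix B :: "ennreal set" assume "B \<in> sets borel"
  then have "{\<xi> \<in> configs. mass \<xi> A \<in> B} \<in> sets config_algebra"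
    unfolding config_algebra_def using assms
    by (subst sets_measure_of) (auto intro!: sigma_sets.Basic)
  then show "(\<lambda>\<xi>. mass \<xi> A) -` B \<inter> space config_algebra \<in> sets config_algebra"
    by (simp add: vimage_def Int_def conj_commute)
qed simp

lemma measurable_config_algebraI:
  fixes f :: "'b \<Rightarrow> 'a::polish_space set"
  assumes "\<And>x. x \<in> space M \<Longrightarrow> f x \<in> configs"
    and "\<And>A. A \<in> sets borel \<Longrightarrow> bounded A \<Longrightarrow> (\<lambda>x. mass (f x) A) \<in> borel_measurable M"
  shows "f \<in> measurable M config_algebra"
  unfolding config_algebra_def
proof (rule measurable_measure_of)
  fix Y :: "'a set set"
  assume "Y \<in> {{\<xi> \<in> configs. mass \<xi> A \<in> B} | A B. A \<in> sets borel \<and> bounded A \<and> B \<in> sets borel}"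
  then obtain A :: "'a set" and B where Y: "Y = {\<xi> \<in> configs. mass \<xi> A \<in> B}"
    and AB: "A \<in> sets borel" "bounded A" "B \<in> sets borel" by blast
  have "f -` Y \<inter> space M = (\<lambda>x. mass (f x) A) -` B \<inter> space M"
    using assms(1) by (auto simp: Y)
  also have "\<dots> \<in> sets M" using assms(2) AB by (intro measurable_sets) auto
  finally show "f -` Y \<inter> space M \<in> sets M" .
qed (use assms(1) in auto)

lemma configs_subset:
  assumes "\<xi> \<in> configs" "\<eta> \<subseteq> \<xi>"
  shows "\<eta> \<in> configs"
proof -
  have "mass \<eta> A < \<infinity>" if "A \<in> sets borel" "bounded A" for A
  proof -
    have "mass \<eta> A \<le> mass \<xi> A" using assms(2) by (intro mass_mono) auto
    also have "\<dots> < \<infinity>" using assms(1) that by (simp add: configs_def)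
    finally show ?thesis .
  qed
  then show ?thesis
    using assms countable_subset by (auto simp: configs_def)
qed

text \<open>A configuration is locally finite, hence closed, so \<open>x \<in> \<xi>\<close> holds as soon as every small ball
  around \<open>x\<close> meets \<open>\<xi>\<close>; with centres in a countable dense set this is a countable condition.\<close>

lemma config_memberI:
  fixes \<xi> :: "'a::polish_space set"
  assumes \<xi>: "\<xi> \<in> configs" and near: "\<And>e. 0 < e \<Longrightarrow> \<exists>y\<in>\<xi>. dist x y < e"
  shows "x \<in> \<xi>"
proof (rule ccontr)
  assume x: "x \<notin> \<xi>"
  have "finite (\<xi> \<inter> ball x 1)"
    using \<xi> by (simp add: configs_def flip: mass_finite_iff)
  then obtain e where e: "0 < e" "\<And>y. y \<in> \<xi> \<inter> ball x 1 \<Longrightarrow> y \<noteq> x \<Longrightarrow> e \<le> dist x y"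
    using finite_set_avoid[of "\<xi> \<inter> ball x 1" x] by blast
  obtain y where "y \<in> \<xi>" "dist x y < min e 1" using near[of "min e 1"] e(1) by auto
  with e(2)[of y] x show False by auto
qed

lemma sets_member_relation:
  "{p \<in> space (config_algebra \<Otimes>\<^sub>M (borel :: 'a::polish_space measure)). snd p \<in> fst p}
     \<in> sets (config_algebra \<Otimes>\<^sub>M borel)"
proof -
  let ?M = "config_algebra \<Otimes>\<^sub>M (borel :: 'a measure)"
  obtain D :: "'a set" where D: "countable D" "\<And>X. open X \<Longrightarrow> X \<noteq> {} \<Longrightarrow> \<exists>d\<in>D. d \<in> X"
    using countable_dense_setE by blast
  let ?r = "\<lambda>n::nat. 1 / (real n + 1)"
  have eq: "snd p \<in> fst p \<longleftrightarrow>
      (\<forall>n. \<exists>d\<in>D. snd p \<in> ball d (?r n) \<and> mass (fst p) (ball d (?r n)) \<noteq> 0)"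
    if p: "p \<in> space ?M" for p
  proof
    assume m: "snd p \<in> fst p"
    show "\<forall>n. \<exists>d\<in>D. snd p \<in> ball d (?r n) \<and> mass (fst p) (ball d (?r n)) \<noteq> 0"
    proof
      fix n
      obtain d where "d \<in> D" "d \<in> ball (snd p) (?r n)"
        using D(2)[of "ball (snd p) (?r n)"] by auto
      with m show "\<exists>d\<in>D. snd p \<in> ball d (?r n) \<and> mass (fst p) (ball d (?r n)) \<noteq> 0"
        by (intro bexI[of _ d]) (auto simp: mass_eq_0_iff dist_commute)
    qed
  next
    assume a: "\<forall>n. \<exists>d\<in>D. snd p \<in> ball d (?r n) \<and> mass (fst p) (ball d (?r n)) \<noteq> 0"
    show "snd p \<in> fst p"
    proof (rule config_memberI)
      show "fst p \<in> configs" using p by (auto simp: space_pair_measure)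
      fix e :: real assume "0 < e"
      then obtain n where n: "?r n < e / 2"
        using nat_approx_posE[of "e / 2"] by (auto simp: add.commute)
      obtain d where "snd p \<in> ball d (?r n)" "fst p \<inter> ball d (?r n) \<noteq> {}"
        using a[rule_format, of n] by (auto simp: mass_eq_0_iff)
      then obtain y where y: "y \<in> fst p" "dist d y < ?r n" "dist d (snd p) < ?r n" by auto
      have "dist (snd p) y \<le> dist d (snd p) + dist d y" by (rule dist_triangle3)
      also have "\<dots> < e" using y n by simp
      finally show "\<exists>y\<in>fst p. dist (snd p) y < e" using y(1) by blast
    qed
  qed
  have ball: "{p \<in> space ?M. snd p \<in> ball d r \<and> mass (fst p) (ball d r) \<noteq> 0} \<in> sets ?M" for d r
  proof -
    have "(\<lambda>\<xi>. mass \<xi> (ball d r)) \<in> borel_measurable config_algebra"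
      by (rule measurable_mass) auto
    then have mass: "(\<lambda>p. mass (fst p) (ball d r)) \<in> borel_measurable ?M"
      by (rule measurable_compose[OF measurable_fst])
    have "{p \<in> space ?M. snd p \<in> ball d r \<and> mass (fst p) (ball d r) \<noteq> 0} =
        (snd -` ball d r \<inter> space ?M) \<inter> ((\<lambda>p. mass (fst p) (ball d r)) -` (- {0}) \<inter> space ?M)"
      by blast
    also have "\<dots> \<in> sets ?M"
      by (intro sets.Int measurable_sets[OF mass] measurable_sets[OF measurable_snd]) auto
    finally show ?thesis .
  qed
  have "{p \<in> space ?M. snd p \<in> fst p} = {p \<in> space ?M. \<forall>n. \<exists>d\<in>D. snd p \<in> ball d (?r n) \<and>
      mass (fst p) (ball d (?r n)) \<noteq> 0}"
    using eq by blast
  also have "\<dots> \<in> sets ?M"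
    by (intro sets.sets_Collect_countable_All sets.sets_Collect_countable_Ex' ball D(1))
  finally show ?thesis .
qed

text \<open>The analogue for the counting kernel of the measurability of section measures. The bound on
  \<open>A\<close> makes the masses finite, which the complement step of the Dynkin argument requires.\<close>

lemma measurable_mass_section:
  fixes E :: "('a::polish_space set \<times> 'a) set"
  assumes E: "E \<in> sets (config_algebra \<Otimes>\<^sub>M borel)" and A: "A \<in> sets borel" "bounded A"
  shows "(\<lambda>\<xi>. mass \<xi> (A \<inter> Pair \<xi> -` E)) \<in> borel_measurable config_algebra"
proof -
  let ?G = "{a \<times> b | a b. a \<in> sets (config_algebra :: 'a set measure) \<and> b \<in> sets (borel :: 'a measure)}"
  let ?\<Omega> = "configs \<times> (UNIV :: 'a set)"
  have [measurable]: "(\<lambda>\<xi>. mass \<xi> A) \<in> borel_measurable config_algebra"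
    by (rule measurable_mass[OF A])
  have "?G \<subseteq> Pow ?\<Omega>"
    using sets.sets_into_space[of _ "config_algebra :: 'a set measure"] by fastforce
  moreover have "E \<in> sigma_sets ?\<Omega> ?G" using E by (simp add: sets_pair_measure)
  ultimately show ?thesis
  proof (induction rule: sigma_sets_induct_disjoint[OF Int_stable_pair_measure_generator,
        consumes 2, case_names basic empty compl union])
    case (basic E)
    then obtain a b where E: "E = a \<times> b" and a [measurable]: "a \<in> sets config_algebra"
      and b: "b \<in> sets borel" by blast
    have [measurable]: "(\<lambda>\<xi>. mass \<xi> (A \<inter> b)) \<in> borel_measurable config_algebra"
      using A b by (intro measurable_mass) auto
    have "mass \<xi> (A \<inter> Pair \<xi> -` E) = indicator a \<xi> * mass \<xi> (A \<inter> b)" for \<xi>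
      by (cases "\<xi> \<in> a") (auto simp: E mass_eq_0_iff)
    then show ?case by simp
  next
    case empty
    have "mass \<xi> {} = 0" for \<xi> :: "'a set" by (simp add: mass_eq_0_iff)
    then show ?case by simp
  next
    case (compl E)
    have "mass \<xi> (A \<inter> Pair \<xi> -` (?\<Omega> - E)) = mass \<xi> A - mass \<xi> (A \<inter> Pair \<xi> -` E)"
      if "\<xi> \<in> configs" for \<xi>
    proof -
      have "finite (\<xi> \<inter> A)" using that A by (simp add: configs_def flip: mass_finite_iff)
      then have "emeasure (count_space UNIV) (\<xi> \<inter> (A \<inter> Pair \<xi> -` E)) \<noteq> \<infinity>"
        by (subst emeasure_count_space_finite) (auto intro: finite_subset[of _ "\<xi> \<inter> A"])
      then have "emeasure (count_space UNIV) (\<xi> \<inter> A - \<xi> \<inter> (A \<inter> Pair \<xi> -` E))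
          = mass \<xi> A - mass \<xi> (A \<inter> Pair \<xi> -` E)"
        unfolding mass_def by (intro emeasure_Diff) auto
      moreover have "\<xi> \<inter> A - \<xi> \<inter> (A \<inter> Pair \<xi> -` E) = \<xi> \<inter> (A \<inter> Pair \<xi> -` (?\<Omega> - E))"
        using that by auto
      ultimately show ?thesis by (simp add: mass_def)
    qed
    moreover have "(\<lambda>\<xi>. mass \<xi> A - mass \<xi> (A \<inter> Pair \<xi> -` E)) \<in> borel_measurable config_algebra"
      using compl by measurable
    ultimately show ?case by (subst measurable_cong) auto
  next
    case (union E)
    have "mass \<xi> (A \<inter> Pair \<xi> -` (\<Union>i. E i)) = (\<Sum>i. mass \<xi> (A \<inter> Pair \<xi> -` E i))" for \<xi>
    proof -
      have "\<xi> \<inter> (A \<inter> Pair \<xi> -` (\<Union>i. E i)) = (\<Union>i. \<xi> \<inter> (A \<inter> Pair \<xi> -` E i))" by auto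
      moreover have "disjoint_family (\<lambda>i. \<xi> \<inter> (A \<inter> Pair \<xi> -` E i))"
        using union(1) by (fastforce simp: disjoint_family_on_def)
      ultimately show ?thesis by (simp add: mass_def suminf_emeasure)
    qed
    then show ?case using union(3) by simp
  qed
qed

section \<open>Patterns along orbits\<close>

text \<open>The points of \<open>\<xi>\<close> that see \<open>\<xi>\<close> along their orbit exactly at the times in \<open>F\<close>. As \<open>F\<close> has no
  negative element, such a point is the first point of \<open>\<xi>\<close> on its orbit.\<close>

definition origins :: "('a \<Rightarrow> 'a) \<Rightarrow> nat set \<Rightarrow> 'a set \<Rightarrow> 'a set" where
  "origins T F \<xi> = {x \<in> \<xi>. \<forall>k. ziter UNIV T k x \<in> \<xi> \<longleftrightarrow> k \<in> int ` F}"

lemma origins_shift: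
  assumes "bij T"
  shows "origins T F (ziter UNIV T k ` \<xi>) = ziter UNIV T k ` origins T F \<xi>"
proof -
  have "ziter UNIV T j (ziter UNIV T k x) = ziter UNIV T k (ziter UNIV T j x)" for j x
    using ziter_add[OF assms, of j k x] ziter_add[OF assms, of k j x] by (simp add: add.commute)
  then show ?thesis
    unfolding origins_def
    by (auto simp: inj_image_mem_iff[OF inj_ziter[OF assms]] inj_eq[OF inj_ziter[OF assms]])
qed

text \<open>Each of two origins on the same orbit sees the other, so neither lies before the other.\<close>

lemma origins_unique:
  assumes "bij T" "x \<in> origins T F \<xi>" "y \<in> origins T G \<xi>" "y = ziter UNIV T k x"
  shows "k = 0" "F = G"
proof -
  have "k \<in> int ` F" using assms(2-4) by (auto simp: origins_def)
  moreover have "ziter UNIV T (- k) y \<in> \<xi>" using assms by (simp add: origins_def)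
  then have "- k \<in> int ` G" using assms(3) by (simp add: origins_def)
  ultimately show k: "k = 0" by auto
  then have "k \<in> int ` F \<longleftrightarrow> k \<in> int ` G" for k using assms(2-4) by (simp add: origins_def)
  then have "int ` F = int ` G" by blast
  then show "F = G" by (simp add: inj_image_eq_iff)
qed

lemma origins_disjoint_shift:
  assumes "bij T" "k \<noteq> 0 \<or> F \<noteq> G"
  shows "origins T F \<xi> \<inter> ziter UNIV T k ` origins T G \<xi> = {}"
proof (rule ccontr)
  assume "\<not> ?thesis"
  then obtain y where y: "y \<in> origins T G \<xi>" "ziter UNIV T k y \<in> origins T F \<xi>" by blast
  from origins_unique[OF assms(1) y refl] assms(2) show False by simp
qed

text \<open>On an orbit that is not periodic, finitely many points occupy finitely many times, and the
  origin is the point at the least of these times. Periodic points have to be excluded, since they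
  return at infinitely many times.\<close>

lemma ex_origin:
  assumes bij: "bij T" and x: "x \<in> \<xi>" and aper: "\<And>n. 0 < n \<Longrightarrow> (T ^^ n) x \<noteq> x"
    and fin: "finite (\<xi> \<inter> orbit T x)"
  obtains F k y where "finite F" "0 \<in> F" "k \<in> F" "y \<in> origins T F \<xi>" "x = ziter UNIV T (int k) y"
proof -
  define K where "K = {k. ziter UNIV T k x \<in> \<xi>}"
  have "(\<lambda>k. ziter UNIV T k x) ` K \<subseteq> \<xi> \<inter> orbit T x" by (auto simp: K_def orbit_def)
  then have "finite ((\<lambda>k. ziter UNIV T k x) ` K)" using fin by (rule finite_subset)
  then have K: "finite K"
    by (rule finite_imageD[OF _ inj_on_subset[OF inj_ziter_orbit[OF bij aper]]]) auto
  have "0 \<in> K" using x by (simp add: K_def)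
  define m where "m = Min K"
  have m: "m \<in> K" "\<And>k. k \<in> K \<Longrightarrow> m \<le> k" using K \<open>0 \<in> K\<close> unfolding m_def by (auto intro: Min_in)
  define y where "y = ziter UNIV T m x"
  define F where "F = (\<lambda>k. nat (k - m)) ` K"
  have F: "k \<in> int ` F \<longleftrightarrow> k + m \<in> K" for k
  proof
    assume "k \<in> int ` F"
    then obtain j where "j \<in> K" "k = int (nat (j - m))" by (auto simp: F_def)
    with m(2)[of j] show "k + m \<in> K" by simp
  next
    assume j: "k + m \<in> K"
    then have "k = int (nat (k + m - m))" using m(2)[of "k + m"] by simp
    with j show "k \<in> int ` F" unfolding F_def by blast
  qed
  have "y \<in> origins T F \<xi>"
    using m(1) F by (simp add: origins_def K_def y_def flip: ziter_add[OF bij])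
  moreover have "x = ziter UNIV T (int (nat (- m))) y"
    using m(2)[OF \<open>0 \<in> K\<close>] bij by (simp add: y_def)
  moreover have "nat (- m) \<in> F" using \<open>0 \<in> K\<close> by (force simp: F_def)
  moreover have "0 \<in> F" using m(1) by (force simp: F_def)
  ultimately show ?thesis
    using that[of F "nat (- m)" y] K by (simp add: F_def)
qed

lemma infsum_eq_suminf_ennreal:
  fixes f :: "nat \<Rightarrow> ennreal"
  shows "infsum f UNIV = suminf f"
  using has_sum_imp_sums[OF has_sum_infsum[of f UNIV]]
  by (simp add: nonneg_summable_on_complete sums_unique)

text \<open>The finite patterns are indexed by their binary codes, so that the sum over the patterns
  becomes a sum over natural numbers. The translates are pairwise disjoint because an origin and
  its pattern are determined by the orbit.\<close>

lemma mass_eq_sum_origins: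
  assumes bij: "bij T" and aper: "\<And>n. 0 < n \<Longrightarrow> \<xi> \<inter> {x. (T ^^ n) x = x} = {}"
    and fin: "\<And>x. finite (\<xi> \<inter> orbit T x)"
  shows "mass \<xi> A = (\<Sum>\<^sub>\<infinity>i\<in>{i. 0 \<in> set_decode i}. \<Sum>k\<in>set_decode i.
           mass (ziter UNIV T (int k) ` origins T (set_decode i) \<xi>) A)"
proof -
  let ?I = "{i. 0 \<in> set_decode i}"
  define V where "V i k = ziter UNIV T (int k) ` origins T (set_decode i) \<xi> \<inter> A" for i k
  define W where "W i = (if i \<in> ?I then (\<Union>k\<in>set_decode i. V i k) else {})" for i
  have V_disj: "i = i' \<and> k = k'" if z: "z \<in> V i k" "z \<in> V i' k'" for i i' k k' z
  proof -
    obtain x y where x: "x \<in> origins T (set_decode i) \<xi>" and y: "y \<in> origins T (set_decode i') \<xi>"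
      and eq: "ziter UNIV T (int k) x = ziter UNIV T (int k') y"
      using z by (auto simp: V_def)
    have "y = ziter UNIV T (- int k' + int k) x"
      using eq ziter_add[OF bij, of "- int k'" "int k" x] bij by (metis ziter_inverse)
    from origins_unique[OF bij x y this] show ?thesis
      by (auto simp: set_decode_inverse dest: arg_cong[where f = set_encode])
  qed
  have "\<xi> \<inter> A = (\<Union>i. W i)"
  proof
    show "\<xi> \<inter> A \<subseteq> (\<Union>i. W i)"
    proof
      fix x assume x: "x \<in> \<xi> \<inter> A"
      then have aper': "(T ^^ n) x \<noteq> x" if "0 < n" for n using aper[OF that] by blast
      obtain F k y where *: "finite F" "0 \<in> F" "k \<in> F" "y \<in> origins T F \<xi>"
        "x = ziter UNIV T (int k) y"
        using ex_origin[OF bij _ aper' fin] x by blast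
      then have "x \<in> V (set_encode F) k" using x by (auto simp: V_def set_encode_inverse)
      with * have "x \<in> W (set_encode F)" by (auto simp: W_def set_encode_inverse simp del: set_decode_0)
      then show "x \<in> (\<Union>i. W i)" by blast
    qed
    show "(\<Union>i. W i) \<subseteq> \<xi> \<inter> A"
      by (auto simp: W_def V_def origins_def split: if_splits)
  qed
  moreover have "disjoint_family W"
    using V_disj by (fastforce simp: disjoint_family_on_def W_def split: if_splits)
  ultimately have "mass \<xi> A = (\<Sum>i. emeasure (count_space UNIV) (W i))"
    by (simp add: mass_def suminf_emeasure)
  also have "\<dots> = (\<Sum>\<^sub>\<infinity>i. emeasure (count_space UNIV) (W i))"
    by (rule infsum_eq_suminf_ennreal[symmetric])
  also have "\<dots> = (\<Sum>\<^sub>\<infinity>i\<in>?I. \<Sum>k\<in>set_decode i. emeasure (count_space UNIV) (V i k))"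
  proof (rule infsum_cong_neutral)
    fix i assume "i \<in> UNIV \<inter> ?I"
    then show "emeasure (count_space UNIV) (W i)
        = (\<Sum>k\<in>set_decode i. emeasure (count_space UNIV) (V i k))"
      using V_disj by (subst sum_emeasure) (auto simp: W_def disjoint_family_on_def)
  qed (auto simp: W_def)
  finally show ?thesis by (simp add: V_def mass_def)
qed

lemma measurable_origins:
  fixes T :: "'a::polish_space \<Rightarrow> 'a"
  assumes T: "\<And>k. ziter UNIV T k \<in> borel_measurable borel"
  shows "origins T F \<in> measurable config_algebra config_algebra"
proof (rule measurable_config_algebraI)
  show "origins T F \<xi> \<in> configs" if "\<xi> \<in> space config_algebra" for \<xi>
    using that configs_subset[of \<xi>] by (auto simp: origins_def)
  fix A :: "'a set" assume A: "A \<in> sets borel" "bounded A"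
  let ?M = "config_algebra \<Otimes>\<^sub>M (borel :: 'a measure)"
  define E where "E = {p \<in> space ?M. \<forall>k. ziter UNIV T k (snd p) \<in> fst p \<longleftrightarrow> k \<in> int ` F}"
  have member: "{p \<in> space ?M. ziter UNIV T k (snd p) \<in> fst p} \<in> sets ?M" for k
  proof -
    have "(\<lambda>p. (fst p, ziter UNIV T k (snd p))) \<in> measurable ?M ?M"
      using T[of k] by measurable
    from measurable_sets[OF this sets_member_relation] show ?thesis
      by (rule back_subst[of "\<lambda>X. X \<in> sets ?M"]) (auto simp: space_pair_measure)
  qed
  have "{p \<in> space ?M. ziter UNIV T k (snd p) \<in> fst p \<longleftrightarrow> k \<in> int ` F} \<in> sets ?M" for k
    using member[of k] sets.sets_Collect_neg[OF member[of k]] by (cases "k \<in> int ` F") auto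
  then have "E \<in> sets ?M" unfolding E_def by (rule sets.sets_Collect_countable_All)
  then have "(\<lambda>\<xi>. mass \<xi> (A \<inter> Pair \<xi> -` E)) \<in> borel_measurable config_algebra"
    using A by (rule measurable_mass_section)
  moreover have "mass (origins T F \<xi>) A = mass \<xi> (A \<inter> Pair \<xi> -` E)" if "\<xi> \<in> configs" for \<xi>
  proof -
    have "origins T F \<xi> \<inter> A = \<xi> \<inter> (A \<inter> Pair \<xi> -` E)"
      using that by (auto simp: origins_def E_def space_pair_measure)
    then show ?thesis by (simp add: mass_def)
  qed
  ultimately show "(\<lambda>\<xi>. mass (origins T F \<xi>) A) \<in> borel_measurable config_algebra"
    by (subst measurable_cong) auto
qed

section \<open>Decomposition of the process\<close>

text \<open>Configurations are determined by their masses on singletons.\<close>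

lemma shift_eq_image:
  fixes \<xi> \<eta> :: "'a::t1_space set"
  assumes "bij T" "\<And>A. A \<in> sets borel \<Longrightarrow> mass \<eta> A = mass \<xi> (T -` A)"
  shows "\<eta> = T ` \<xi>"
proof (rule set_eqI)
  fix x
  have "x \<notin> \<eta> \<longleftrightarrow> mass \<eta> {x} = 0" by (auto simp: mass_eq_0_iff)
  also have "\<dots> \<longleftrightarrow> mass \<xi> (T -` {x}) = 0" by (simp add: assms(2))
  also have "\<dots> \<longleftrightarrow> x \<notin> T ` \<xi>" by (auto simp: mass_eq_0_iff)
  finally show "x \<in> \<eta> \<longleftrightarrow> x \<in> T ` \<xi>" by blast
qed

text \<open>The relation for negative powers of \<open>S\<close> follows from the one for \<open>S\<close>, since almost every \<open>\<omega>\<close>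
  satisfies the latter along its entire orbit.\<close>

lemma process_ziter:
  fixes N :: "'w \<Rightarrow> 'a::polish_space set"
  assumes bij: "bij T" and S: "mp_automorphism P S" and N: "T_point_process \<mu> T P S N"
  shows "AE \<omega> in P. \<forall>k. N (ziter (space P) S k \<omega>) = ziter UNIV T k ` N \<omega>"
proof -
  have "AE \<omega> in P. N (S \<omega>) = T ` N \<omega>"
    using N unfolding T_point_process_def by (auto elim!: eventually_mono intro!: shift_eq_image[OF bij])
  from AE_all_ziter[OF S this] AE_space show ?thesis
  proof eventually_elim
    case (elim \<omega>)
    have bS: "bij_betw S (space P) (space P)" using S by (simp add: mp_automorphism_def)
    \<comment> \<open>Both sides satisfy the same one-step recursion, which also determines the preceding term
      since \<open>T\<close> is injective.\<close>
    have step: "N (ziter (space P) S (k + 1) \<omega>) = T ` N (ziter (space P) S k \<omega>)" for k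
      using elim by (simp add: ziter_Suc[OF bS])
    have stepT: "ziter UNIV T (k + 1) ` N \<omega> = T ` ziter UNIV T k ` N \<omega>" for k
      by (simp add: ziter_Suc[OF bij] image_image)
    show ?case
    proof
      fix k
      show "N (ziter (space P) S k \<omega>) = ziter UNIV T k ` N \<omega>"
      proof (induction k rule: int_induct[of _ 0])
        case (step2 i)
        then have "T ` N (ziter (space P) S (i - 1) \<omega>) = T ` ziter UNIV T (i - 1) ` N \<omega>"
          using step[of "i - 1"] stepT[of "i - 1"] by simp
        then show ?case using bij by (simp add: bij_is_inj inj_image_eq_iff)
      qed (simp_all add: step stepT)
    qed
  qed
qed

theorem proposition2p5:
  fixes \<mu> :: "'a::polish_space measure" and T :: "'a \<Rightarrow> 'a"
    and P :: "'w measure" and S :: "'w \<Rightarrow> 'w" and N :: "'w \<Rightarrow> 'a set"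
  assumes "conservative_ergodic_infinite_system \<mu> T"
    and "prob_space P"
    and "mp_automorphism P S"
    and "T_point_process \<mu> T P S N"
    and "AE \<omega> in P. \<forall>x. mass (N \<omega>) (orbit T x) < \<infinity>"
  shows "\<exists>(I :: nat set) (F :: nat \<Rightarrow> nat set) (NF :: nat set \<Rightarrow> 'w \<Rightarrow> 'a set).
           (\<forall>i\<in>I. finite (F i)) \<and>
           (\<forall>i\<in>I. T_point_process \<mu> T P S (NF (F i)) \<and>
                   free_process P S (NF (F i)) \<and>
                   measurable_wrt P N (NF (F i))) \<and>
           (\<forall>i\<in>I. \<forall>j\<in>I. i \<noteq> j \<longrightarrow> dissociated P S (NF (F i)) (NF (F j))) \<and>
           (AE \<omega> in P. \<forall>A\<in>sets borel.
              mass (N \<omega>) A = (\<Sum>\<^sub>\<infinity>i\<in>I. \<Sum>k\<in>F i. mass (NF (F i) ((S ^^ k) \<omega>)) A))"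
proof -
  have sets: "sets \<mu> = sets borel" and mpT: "mp_automorphism \<mu> T"
    using assms(1) by (auto simp: conservative_ergodic_infinite_system_def)
  have space: "space \<mu> = UNIV" using sets_eq_imp_space_eq[OF sets] by simp
  have bij: "bij T" using mpT by (simp add: mp_automorphism_def space)
  have T_meas: "ziter UNIV T k \<in> borel_measurable borel" for k
    using mp_automorphism_ziter(1)[OF mpT, of k] measurable_cong_sets[OF sets sets]
    by (simp add: space)
  have N: "N \<in> measurable P config_algebra"
    and N_null: "\<And>A. A \<in> sets borel \<Longrightarrow> emeasure \<mu> A = 0 \<Longrightarrow> AE \<omega> in P. mass (N \<omega>) A = 0"
    using assms(4) by (auto simp: T_point_process_def)
  define NF where "NF F \<omega> = origins T F (N \<omega>)" for F \<omega>
  have shift: "AE \<omega> in P. \<forall>k. N (ziter (space P) S k \<omega>) = ziter UNIV T k ` N \<omega>"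
    by (rule process_ziter[OF bij assms(3,4)])
  then have NF_shift: "AE \<omega> in P. \<forall>F k. NF F (ziter (space P) S k \<omega>) = ziter UNIV T k ` NF F \<omega>"
    by eventually_elim (simp add: NF_def origins_shift[OF bij])
  have NF_process: "T_point_process \<mu> T P S (NF F)" for F
    unfolding T_point_process_def
  proof (intro conjI ballI impI)
    show "NF F \<in> measurable P config_algebra"
      unfolding NF_def using N measurable_origins[OF T_meas] by (rule measurable_compose)
    show "AE \<omega> in P. mass (NF F \<omega>) A = 0" if "A \<in> sets borel" "emeasure \<mu> A = 0" for A
      using N_null[OF that] by eventually_elim (auto simp: mass_eq_0_iff NF_def origins_def)
    show "AE \<omega> in P. \<forall>A\<in>sets borel. mass (NF F (S \<omega>)) A = mass (NF F \<omega>) (T -` A)"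
      using NF_shift
    proof eventually_elim
      case (elim \<omega>)
      from elim[rule_format, of F 1] have "NF F (S \<omega>) = T ` NF F \<omega>"
        by (simp add: ziter_def)
      then show ?case using mass_image[OF bij_is_inj[OF bij]] by simp
    qed
  qed
  have NF_free: "free_process P S (NF F)" for F
    unfolding free_process_def using NF_shift
    by eventually_elim (simp add: NF_def origins_disjoint_shift[OF bij])
  have NF_wrt: "measurable_wrt P N (NF F)" for F
    unfolding measurable_wrt_def NF_def
    using measurable_vimage_algebra1[of N "space P" config_algebra] measurable_space[OF N]
      measurable_origins[OF T_meas]
    by (intro measurable_compose[where g = "origins T F" and f = N]) auto
  have NF_dissociated: "dissociated P S (NF F) (NF G)" if "F \<noteq> G" for F G
    unfolding dissociated_def using NF_shift
    by eventually_elim (simp add: NF_def origins_disjoint_shift[OF bij] that)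
  have "AE \<omega> in P. 0 < n \<longrightarrow> N \<omega> \<inter> {x. (T ^^ n) x = x} = {}" for n
    using N_null periodic_points_null[OF assms(1), of n]
    by (cases "0 < n") (simp_all add: mass_eq_0_iff)
  then have "AE \<omega> in P. \<forall>n. 0 < n \<longrightarrow> N \<omega> \<inter> {x. (T ^^ n) x = x} = {}"
    by (simp add: AE_all_countable)
  then have NF_sum: "AE \<omega> in P. \<forall>A\<in>sets borel. mass (N \<omega>) A =
      (\<Sum>\<^sub>\<infinity>i\<in>{i. 0 \<in> set_decode i}. \<Sum>k\<in>set_decode i. mass (NF (set_decode i) ((S ^^ k) \<omega>)) A)"
    using NF_shift assms(5)
  proof eventually_elim
    case (elim \<omega>)
    have "NF F ((S ^^ k) \<omega>) = ziter UNIV T (int k) ` origins T F (N \<omega>)" for F k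
      using elim(2)[rule_format, of F "int k"] by (simp add: NF_def ziter_of_nat)
    moreover have "finite (N \<omega> \<inter> orbit T x)" for x
      using elim(3) by (simp only: mass_finite_iff)
    ultimately show ?case
      using mass_eq_sum_origins[OF bij, of "N \<omega>"] elim(1) by simp
  qed
  have "set_decode i \<noteq> set_decode j" if "i \<noteq> j" for i j
    using that by (metis set_decode_inverse)
  then show ?thesis
    using NF_process NF_free NF_wrt NF_dissociated NF_sum
    by (intro exI[of _ "{i. 0 \<in> set_decode i}"] exI[of _ set_decode] exI[of _ NF]) auto
qed

end
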